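(* Let $L:\mathbb{A}\to\mathbb{B}$, $R:\mathbb{B}\to\mathbb{A}$ be functors, $(R,L,\tilde\alpha,\tilde\beta)$ a regular pairing with $\tilde\alpha$ symmetric (with associated $\tilde\eta:I_{\mathbb{B}}\to LR$, $\tilde\varepsilon:RL\to I_{\mathbb{A}}$, $\tilde\ell:L\to L$, $\tilde r:R\to R$), and $\eta:I_{\mathbb{A}}\to RL$ any natural transformation. Then: (1) $\hat\eta:=\tilde r\tilde\ell\cdot\eta:I_{\mathbb{A}}\to RL$ is a natural transformation with $\hat\eta=\tilde r\tilde\ell\cdot\hat\eta$, and $L\hat\eta R=L\hat\eta R\cdot\tilde\ell\tilde r$, that is, $L\hat\eta R$ is $\tilde\ell\tilde r$-compatible as an $LR$-module morphism. (2) $(LR,L\tilde\varepsilon R,\tilde\eta)$ is a weak monad, and if $\varrho:LR(B)\to B$ is an $\tilde\ell\tilde r$-compatible $LR$-module, there is a unique $\tilde\ell\tilde r$-compatible module morphism $\omega:B\to LR(B)$ making $(B,\varrho,\omega)$ a Frobenius $(LR,\hat\eta,\tilde\varepsilon)$-bimodule, given by $$\omega:\ B\xrightarrow{\tilde\eta_B}LR(B)\xrightarrow{L\hat\eta_{R(B)}}LRLR(B)\xrightarrow{LR(\varrho)}LR(B).$$ (3) $LR$-module morphisms between $\tilde\ell\tilde r$-compatible $LR$-modules $(B,\varrho)$, $(B',\varrho')$ are $(LR,\hat\eta,\tilde\varepsilon)$-bimodule morphisms between $(B,\varrho,\omega)$ and $(B',\varrho',\omega')$, where $\omega,\omega'$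 are the morphisms given in (2).
   Context: A pairing $(R,L,\tilde\alpha,\tilde\beta)$ consists of maps $\tilde\alpha:\mathrm{Mor}_{\mathbb{A}}(R(B),A)\to\mathrm{Mor}_{\mathbb{B}}(B,L(A))$ and $\tilde\beta$ in the opposite direction, natural in $A\in\mathbb{A}$, $B\in\mathbb{B}$. It determines (and is determined by) natural transformations $\tilde\eta:I_{\mathbb{B}}\to LR$ ($\tilde\eta_B=\tilde\alpha(I_{R(B)})$) and $\tilde\varepsilon:RL\to I_{\mathbb{A}}$ ($\tilde\varepsilon_A=\tilde\beta(I_{L(A)})$). Put $\tilde r:=\tilde\varepsilon R\cdot R\tilde\eta:R\to R$ and $\tilde\ell:=L\tilde\varepsilon\cdot\tilde\eta L:L\to L$. The pairing is regular if $\tilde\alpha\tilde\beta\tilde\alpha=\tilde\alpha$ and $\tilde\beta\tilde\alpha\tilde\beta=\tilde\beta$. $\tilde\alpha$ is symmetric if $L\tilde r=\tilde\ell R$. $\tilde\ell\tilde r:LR\to LR$ and $\tilde r\tilde\ell:RL\to RL$ denote horizontal composites. A weak monad $(F,m,\eta')$ is an endofunctor $F$ with associative $m:FF\to F$ and a natural $\eta':I\to F$ such that $\eta'=m\cdot F\eta'\cdot\eta'$, $m=m\cdot mF\cdot F\eta'F$, $m\cdot F\eta'=m\cdot\eta'F$. $LR$-modules are non-unital modules for $(LR,L\tilde\varepsilon R)$: pairs $(B,\varrho)$, $\varrho:LR(B)\to B$, with $\varrho\cdot LR(\varrho)=\varrho\cdot L\tilde\varepsilon_{R(B)}$. $LR(B)$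 is a module via $L\tilde\varepsilon_{R(B)}$. $(B,\varrho)$ is $\tilde\ell\tilde r$-compatible if $\varrho\cdot(\tilde\ell\tilde r)_B=\varrho$. A module morphism $h:(B,\varrho)\to(B',\varrho')$ is $\tilde\ell\tilde r$-compatible if $h\cdot\varrho\cdot\tilde\eta_B=h$ (equivalently $\varrho'\cdot\tilde\eta_{B'}\cdot h=h$); a module morphism $h:LR(B)\to Q$ is $\tilde\ell\tilde r$-compatible iff $h\cdot(\tilde\ell\tilde r)_B=h$. For $\hat\eta:I_{\mathbb{A}}\to RL$ and $\tilde\varepsilon:RL\to I_{\mathbb{A}}$, a Frobenius $(LR,\hat\eta,\tilde\varepsilon)$-bimodule is a triple $(B,\varrho,\omega)$ with $(B,\varrho)$ a non-unital $(LR,L\tilde\varepsilon R)$-module, $(B,\omega)$ a non-counital comodule over $(LR,L\hat\eta R)$ (i.e. $LR(\omega)\cdot\omega=L\hat\eta_{R(B)}\cdot\omega$), and $LR(\varrho)\cdot L\hat\eta_{R(B)}=\omega\cdot\varrho=L\tilde\varepsilon_{R(B)}\cdot LR(\omega)$. Bimodule morphisms are morphisms in $\mathbb{B}$ that are both module and comodule morphisms. *)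

theory Defs
  imports Main
begin

record ('o, 'm) cat =
  Obj :: "'o set"
  Arr :: "'m set"
  Dom :: "'m \<Rightarrow> 'o"
  Cod :: "'m \<Rightarrow> 'o"
  Id :: "'o \<Rightarrow> 'm"
  Comp :: "'m \<Rightarrow> 'm \<Rightarrow> 'm" (infixr "\<cdot>\<index>" 70)

definition hom :: "('o, 'm) cat \<Rightarrow> 'o \<Rightarrow> 'o \<Rightarrow> 'm set" where
  "hom C X Y = {f \<in> Arr C. Dom C f = X \<and> Cod C f = Y}"

locale category =
  fixes C :: "('o, 'm) cat" (structure)
  assumes Dom_in_Obj: "f \<in> Arr C \<Longrightarrow> Dom C f \<in> Obj C"
    and Cod_in_Obj: "f \<in> Arr C \<Longrightarrow> Cod C f \<in> Obj C"
    and Id_in_hom: "X \<in> Obj C \<Longrightarrow> Id C X \<in> hom C X X"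
    and Comp_in_hom: "f \<in> hom C X Y \<Longrightarrow> g \<in> hom C Y Z \<Longrightarrow> g \<cdot> f \<in> hom C X Z"
    and Comp_Id_left: "f \<in> hom C X Y \<Longrightarrow> Id C Y \<cdot> f = f"
    and Comp_Id_right: "f \<in> hom C X Y \<Longrightarrow> f \<cdot> Id C X = f"
    and Comp_assoc: "f \<in> hom C W X \<Longrightarrow> g \<in> hom C X Y \<Longrightarrow> h \<in> hom C Y Z
      \<Longrightarrow> (h \<cdot> g) \<cdot> f = h \<cdot> (g \<cdot> f)"

record ('oa, 'ma, 'ob, 'mb) fctr =
  omap :: "'oa \<Rightarrow> 'ob"
  amap :: "'ma \<Rightarrow> 'mb"

locale cat_functor = A: category A + B: category B
  for A :: "('oa, 'ma) cat" and B :: "('ob, 'mb) cat" +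
  fixes F :: "('oa, 'ma, 'ob, 'mb) fctr"
  assumes omap_in_Obj: "X \<in> Obj A \<Longrightarrow> omap F X \<in> Obj B"
    and amap_in_hom: "f \<in> hom A X Y \<Longrightarrow> amap F f \<in> hom B (omap F X) (omap F Y)"
    and amap_Id: "X \<in> Obj A \<Longrightarrow> amap F (Id A X) = Id B (omap F X)"
    and amap_Comp: "f \<in> hom A X Y \<Longrightarrow> g \<in> hom A Y Z
      \<Longrightarrow> amap F (g \<cdot>\<^bsub>A\<^esub> f) = amap F g \<cdot>\<^bsub>B\<^esub> amap F f"

definition id_fctr :: "('o, 'm, 'o, 'm) fctr" where
  "id_fctr = \<lparr>omap = (\<lambda>X. X), amap = (\<lambda>f. f)\<rparr>"

definition fctr_comp ::
  "('ob, 'mb, 'oc, 'mc) fctr \<Rightarrow> ('oa, 'ma, 'ob, 'mb) fctr \<Rightarrow> ('oa, 'ma, 'oc, 'mc) fctr"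
  (infixr "\<circ>\<^sub>F" 75) where
  "G \<circ>\<^sub>F F = \<lparr>omap = (\<lambda>X. omap G (omap F X)), amap = (\<lambda>f. amap G (amap F f))\<rparr>"

text \<open>A natural transformation is given by its family of components; only the components at
  objects of the source category matter, so equations between natural transformations are stated
  objectwise.\<close>

locale nat_transf = F: cat_functor A B F + G: cat_functor A B G
  for A :: "('oa, 'ma) cat" and B :: "('ob, 'mb) cat"
    and F :: "('oa, 'ma, 'ob, 'mb) fctr" and G :: "('oa, 'ma, 'ob, 'mb) fctr" +
  fixes \<tau> :: "'oa \<Rightarrow> 'mb"
  assumes component_in_hom: "X \<in> Obj A \<Longrightarrow> \<tau> X \<in> hom B (omap F X) (omap G X)"
    and naturality: "f \<in> hom A X Y \<Longrightarrow> \<tau> Y \<cdot>\<^bsub>B\<^esub> amap F f = amap G f \<cdot>\<^bsub>B\<^esub> \<tau> X"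

definition vcomp :: "('ob, 'mb) cat \<Rightarrow> ('oa \<Rightarrow> 'mb) \<Rightarrow> ('oa \<Rightarrow> 'mb) \<Rightarrow> 'oa \<Rightarrow> 'mb" where
  "vcomp B \<sigma> \<tau> = (\<lambda>X. \<sigma> X \<cdot>\<^bsub>B\<^esub> \<tau> X)"

text \<open>Whiskerings \<open>F\<tau>\<close> and \<open>\<tau>F\<close>.\<close>

definition whisker_left ::
  "('ob, 'mb, 'oc, 'mc) fctr \<Rightarrow> ('oa \<Rightarrow> 'mb) \<Rightarrow> 'oa \<Rightarrow> 'mc" (infixr "\<triangleright>" 86) where
  "F \<triangleright> \<tau> = (\<lambda>X. amap F (\<tau> X))"

definition whisker_right ::
  "('ob \<Rightarrow> 'mc) \<Rightarrow> ('oa, 'ma, 'ob, 'mb) fctr \<Rightarrow> 'oa \<Rightarrow> 'mc" (infixl "\<triangleleft>" 85) where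
  "\<tau> \<triangleleft> F = (\<lambda>X. \<tau> (omap F X))"

text \<open>Horizontal composite \<open>\<sigma>\<tau> : FG \<rightarrow> F'G'\<close> of \<open>\<sigma> : F \<rightarrow> F'\<close> and \<open>\<tau> : G \<rightarrow> G'\<close>, with values in \<open>C\<close>,
  computed as \<open>\<sigma>G' \<cdot> F\<tau>\<close>.\<close>

definition hcomp ::
  "('oc, 'mc) cat \<Rightarrow> ('ob, 'mb, 'oc, 'mc) fctr \<Rightarrow> ('oa, 'ma, 'ob, 'mb) fctr
    \<Rightarrow> ('ob \<Rightarrow> 'mc) \<Rightarrow> ('oa \<Rightarrow> 'mb) \<Rightarrow> 'oa \<Rightarrow> 'mc" where
  "hcomp C F G' \<sigma> \<tau> = vcomp C (\<sigma> \<triangleleft> G') (F \<triangleright> \<tau>)"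

text \<open>\<open>\<alpha> Y X\<close> and \<open>\<beta> Y X\<close> are the maps between \<open>Mor\<^sub>A(R Y, X)\<close> and \<open>Mor\<^sub>B(Y, L X)\<close>.\<close>

locale pairing = L: cat_functor A B L + R: cat_functor B A R
  for A :: "('oa, 'ma) cat" and B :: "('ob, 'mb) cat"
    and R :: "('ob, 'mb, 'oa, 'ma) fctr" and L :: "('oa, 'ma, 'ob, 'mb) fctr" +
  fixes \<alpha> :: "'ob \<Rightarrow> 'oa \<Rightarrow> 'ma \<Rightarrow> 'mb" and \<beta> :: "'ob \<Rightarrow> 'oa \<Rightarrow> 'mb \<Rightarrow> 'ma"
  assumes alpha_in_hom: "\<lbrakk>Y \<in> Obj B; X \<in> Obj A; f \<in> hom A (omap R Y) X\<rbrakk>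
      \<Longrightarrow> \<alpha> Y X f \<in> hom B Y (omap L X)"
    and beta_in_hom: "\<lbrakk>Y \<in> Obj B; X \<in> Obj A; g \<in> hom B Y (omap L X)\<rbrakk>
      \<Longrightarrow> \<beta> Y X g \<in> hom A (omap R Y) X"
    and alpha_natural: "\<lbrakk>k \<in> hom B Y' Y; h \<in> hom A X X'; f \<in> hom A (omap R Y) X\<rbrakk>
      \<Longrightarrow> \<alpha> Y' X' (h \<cdot>\<^bsub>A\<^esub> f \<cdot>\<^bsub>A\<^esub> amap R k) = amap L h \<cdot>\<^bsub>B\<^esub> \<alpha> Y X f \<cdot>\<^bsub>B\<^esub> k"
    and beta_natural: "\<lbrakk>k \<in> hom B Y' Y; h \<in> hom A X X'; g \<in> hom B Y (omap L X)\<rbrakk>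
      \<Longrightarrow> \<beta> Y' X' (amap L h \<cdot>\<^bsub>B\<^esub> g \<cdot>\<^bsub>B\<^esub> k) = h \<cdot>\<^bsub>A\<^esub> \<beta> Y X g \<cdot>\<^bsub>A\<^esub> amap R k"

locale regular_pairing = pairing A B R L \<alpha> \<beta>
  for A :: "('oa, 'ma) cat" and B :: "('ob, 'mb) cat"
    and R :: "('ob, 'mb, 'oa, 'ma) fctr" and L :: "('oa, 'ma, 'ob, 'mb) fctr"
    and \<alpha> :: "'ob \<Rightarrow> 'oa \<Rightarrow> 'ma \<Rightarrow> 'mb" and \<beta> :: "'ob \<Rightarrow> 'oa \<Rightarrow> 'mb \<Rightarrow> 'ma" +
  assumes alpha_regular: "\<lbrakk>Y \<in> Obj B; X \<in> Obj A; f \<in> hom A (omap R Y) X\<rbrakk>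
      \<Longrightarrow> \<alpha> Y X (\<beta> Y X (\<alpha> Y X f)) = \<alpha> Y X f"
    and beta_regular: "\<lbrakk>Y \<in> Obj B; X \<in> Obj A; g \<in> hom B Y (omap L X)\<rbrakk>
      \<Longrightarrow> \<beta> Y X (\<alpha> Y X (\<beta> Y X g)) = \<beta> Y X g"

definition pairing_unit ::
  "('oa, 'ma) cat \<Rightarrow> ('ob, 'mb, 'oa, 'ma) fctr \<Rightarrow> ('ob \<Rightarrow> 'oa \<Rightarrow> 'ma \<Rightarrow> 'mb) \<Rightarrow> 'ob \<Rightarrow> 'mb" where
  "pairing_unit A R \<alpha> = (\<lambda>Y. \<alpha> Y (omap R Y) (Id A (omap R Y)))"

definition pairing_counit ::
  "('ob, 'mb) cat \<Rightarrow> ('oa, 'ma, 'ob, 'mb) fctr \<Rightarrow> ('ob \<Rightarrow> 'oa \<Rightarrow> 'mb \<Rightarrow> 'ma) \<Rightarrow> 'oa \<Rightarrow> 'ma" where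
  "pairing_counit B L \<beta> = (\<lambda>X. \<beta> (omap L X) X (Id B (omap L X)))"

text \<open>The endomorphisms \<open>r = \<epsilon>R \<cdot> R\<eta>\<close> of \<open>R\<close> and \<open>\<ell> = L\<epsilon> \<cdot> \<eta>L\<close> of \<open>L\<close>.\<close>

definition pairing_r ::
  "('oa, 'ma) cat \<Rightarrow> ('ob, 'mb, 'oa, 'ma) fctr \<Rightarrow> ('ob \<Rightarrow> 'mb) \<Rightarrow> ('oa \<Rightarrow> 'ma) \<Rightarrow> 'ob \<Rightarrow> 'ma" where
  "pairing_r A R \<eta> \<epsilon> = vcomp A (\<epsilon> \<triangleleft> R) (R \<triangleright> \<eta>)"

definition pairing_l ::
  "('ob, 'mb) cat \<Rightarrow> ('oa, 'ma, 'ob, 'mb) fctr \<Rightarrow> ('ob \<Rightarrow> 'mb) \<Rightarrow> ('oa \<Rightarrow> 'ma) \<Rightarrow> 'oa \<Rightarrow> 'mb" where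
  "pairing_l B L \<eta> \<epsilon> = vcomp B (L \<triangleright> \<epsilon>) (\<eta> \<triangleleft> L)"

definition symmetric_alpha ::
  "('oa, 'ma) cat \<Rightarrow> ('ob, 'mb) cat \<Rightarrow> ('ob, 'mb, 'oa, 'ma) fctr \<Rightarrow> ('oa, 'ma, 'ob, 'mb) fctr
    \<Rightarrow> ('ob \<Rightarrow> 'oa \<Rightarrow> 'ma \<Rightarrow> 'mb) \<Rightarrow> ('ob \<Rightarrow> 'oa \<Rightarrow> 'mb \<Rightarrow> 'ma) \<Rightarrow> bool" where
  "symmetric_alpha A B R L \<alpha> \<beta> \<longleftrightarrow>
    (let \<eta> = pairing_unit A R \<alpha>; \<epsilon> = pairing_counit B L \<beta>
     in \<forall>Y \<in> Obj B. (L \<triangleright> pairing_r A R \<eta> \<epsilon>) Y = (pairing_l B L \<eta> \<epsilon> \<triangleleft> R) Y)"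

locale weak_monad = F: cat_functor C C F + m: nat_transf C C "F \<circ>\<^sub>F F" F m
    + e: nat_transf C C id_fctr F e
  for C :: "('o, 'm) cat" and F :: "('o, 'm, 'o, 'm) fctr"
    and m :: "'o \<Rightarrow> 'm" and e :: "'o \<Rightarrow> 'm" +
  assumes m_assoc: "X \<in> Obj C \<Longrightarrow> vcomp C m (F \<triangleright> m) X = vcomp C m (m \<triangleleft> F) X"
    and e_regular: "X \<in> Obj C \<Longrightarrow> e X = vcomp C m (vcomp C (F \<triangleright> e) e) X"
    and m_compatible: "X \<in> Obj C \<Longrightarrow> m X = vcomp C m (vcomp C (m \<triangleleft> F) (F \<triangleright> e \<triangleleft> F)) X"
    and e_symmetric: "X \<in> Obj C \<Longrightarrow> vcomp C m (F \<triangleright> e) X = vcomp C m (e \<triangleleft> F) X"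

definition nonunital_module ::
  "('o, 'm) cat \<Rightarrow> ('o, 'm, 'o, 'm) fctr \<Rightarrow> ('o \<Rightarrow> 'm) \<Rightarrow> 'o \<Rightarrow> 'm \<Rightarrow> bool" where
  "nonunital_module C F m X \<rho> \<longleftrightarrow>
     X \<in> Obj C \<and> \<rho> \<in> hom C (omap F X) X \<and> \<rho> \<cdot>\<^bsub>C\<^esub> amap F \<rho> = \<rho> \<cdot>\<^bsub>C\<^esub> m X"

definition module_morphism ::
  "('o, 'm) cat \<Rightarrow> ('o, 'm, 'o, 'm) fctr \<Rightarrow> ('o \<Rightarrow> 'm) \<Rightarrow> 'o \<Rightarrow> 'm \<Rightarrow> 'o \<Rightarrow> 'm \<Rightarrow> 'm \<Rightarrow> bool" where
  "module_morphism C F m X \<rho> X' \<rho>' h \<longleftrightarrow>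
     nonunital_module C F m X \<rho> \<and> nonunital_module C F m X' \<rho>' \<and>
     h \<in> hom C X X' \<and> h \<cdot>\<^bsub>C\<^esub> \<rho> = \<rho>' \<cdot>\<^bsub>C\<^esub> amap F h"

definition noncounital_comodule ::
  "('o, 'm) cat \<Rightarrow> ('o, 'm, 'o, 'm) fctr \<Rightarrow> ('o \<Rightarrow> 'm) \<Rightarrow> 'o \<Rightarrow> 'm \<Rightarrow> bool" where
  "noncounital_comodule C F d X \<omega> \<longleftrightarrow>
     X \<in> Obj C \<and> \<omega> \<in> hom C X (omap F X) \<and> amap F \<omega> \<cdot>\<^bsub>C\<^esub> \<omega> = d X \<cdot>\<^bsub>C\<^esub> \<omega>"

definition comodule_morphism ::
  "('o, 'm) cat \<Rightarrow> ('o, 'm, 'o, 'm) fctr \<Rightarrow> ('o \<Rightarrow> 'm) \<Rightarrow> 'o \<Rightarrow> 'm \<Rightarrow> 'o \<Rightarrow> 'm \<Rightarrow> 'm \<Rightarrow> bool" where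
  "comodule_morphism C F d X \<omega> X' \<omega>' h \<longleftrightarrow>
     noncounital_comodule C F d X \<omega> \<and> noncounital_comodule C F d X' \<omega>' \<and>
     h \<in> hom C X X' \<and> amap F h \<cdot>\<^bsub>C\<^esub> \<omega> = \<omega>' \<cdot>\<^bsub>C\<^esub> h"

text \<open>In the next two definitions \<open>u\<close> stands for the endomorphism \<open>\<ell>r\<close> of \<open>F = LR\<close>, and \<open>e\<close> for the
  quasi-unit \<open>I \<rightarrow> LR\<close> of the pairing.\<close>

definition compatible_module ::
  "('o, 'm) cat \<Rightarrow> ('o, 'm, 'o, 'm) fctr \<Rightarrow> ('o \<Rightarrow> 'm) \<Rightarrow> ('o \<Rightarrow> 'm) \<Rightarrow> 'o \<Rightarrow> 'm \<Rightarrow> bool" where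
  "compatible_module C F m u X \<rho> \<longleftrightarrow> nonunital_module C F m X \<rho> \<and> \<rho> \<cdot>\<^bsub>C\<^esub> u X = \<rho>"

definition compatible_module_morphism ::
  "('o, 'm) cat \<Rightarrow> ('o, 'm, 'o, 'm) fctr \<Rightarrow> ('o \<Rightarrow> 'm) \<Rightarrow> ('o \<Rightarrow> 'm)
    \<Rightarrow> 'o \<Rightarrow> 'm \<Rightarrow> 'o \<Rightarrow> 'm \<Rightarrow> 'm \<Rightarrow> bool" where
  "compatible_module_morphism C F m e X \<rho> X' \<rho>' h \<longleftrightarrow>
     module_morphism C F m X \<rho> X' \<rho>' h \<and> h \<cdot>\<^bsub>C\<^esub> \<rho> \<cdot>\<^bsub>C\<^esub> e X = h"

text \<open>Frobenius \<open>(LR, \<eta>, \<epsilon>)\<close>-bimodules, for \<open>\<eta> : I \<rightarrow> RL\<close> and \<open>\<epsilon> : RL \<rightarrow> I\<close>.\<close>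

definition frobenius_bimodule ::
  "('ob, 'mb) cat \<Rightarrow> ('ob, 'mb, 'oa, 'ma) fctr \<Rightarrow> ('oa, 'ma, 'ob, 'mb) fctr
    \<Rightarrow> ('oa \<Rightarrow> 'ma) \<Rightarrow> ('oa \<Rightarrow> 'ma) \<Rightarrow> 'ob \<Rightarrow> 'mb \<Rightarrow> 'mb \<Rightarrow> bool" where
  "frobenius_bimodule B R L \<eta> \<epsilon> Y \<rho> \<omega> \<longleftrightarrow>
     nonunital_module B (L \<circ>\<^sub>F R) (L \<triangleright> \<epsilon> \<triangleleft> R) Y \<rho> \<and>
     noncounital_comodule B (L \<circ>\<^sub>F R) (L \<triangleright> \<eta> \<triangleleft> R) Y \<omega> \<and>
     amap (L \<circ>\<^sub>F R) \<rho> \<cdot>\<^bsub>B\<^esub> (L \<triangleright> \<eta> \<triangleleft> R) Y = \<omega> \<cdot>\<^bsub>B\<^esub> \<rho> \<and>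
     \<omega> \<cdot>\<^bsub>B\<^esub> \<rho> = (L \<triangleright> \<epsilon> \<triangleleft> R) Y \<cdot>\<^bsub>B\<^esub> amap (L \<circ>\<^sub>F R) \<omega>"

definition bimodule_morphism ::
  "('ob, 'mb) cat \<Rightarrow> ('ob, 'mb, 'oa, 'ma) fctr \<Rightarrow> ('oa, 'ma, 'ob, 'mb) fctr
    \<Rightarrow> ('oa \<Rightarrow> 'ma) \<Rightarrow> ('oa \<Rightarrow> 'ma) \<Rightarrow> 'ob \<Rightarrow> 'mb \<Rightarrow> 'mb \<Rightarrow> 'ob \<Rightarrow> 'mb \<Rightarrow> 'mb \<Rightarrow> 'mb \<Rightarrow> bool" where
  "bimodule_morphism B R L \<eta> \<epsilon> Y \<rho> \<omega> Y' \<rho>' \<omega>' h \<longleftrightarrow>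
     frobenius_bimodule B R L \<eta> \<epsilon> Y \<rho> \<omega> \<and> frobenius_bimodule B R L \<eta> \<epsilon> Y' \<rho>' \<omega>' \<and>
     module_morphism B (L \<circ>\<^sub>F R) (L \<triangleright> \<epsilon> \<triangleleft> R) Y \<rho> Y' \<rho>' h \<and>
     comodule_morphism B (L \<circ>\<^sub>F R) (L \<triangleright> \<eta> \<triangleleft> R) Y \<omega> Y' \<omega>' h"

text \<open>The coaction \<open>LR(\<rho>) \<cdot> L\<eta>\<^bsub>R(Y)\<^esub> \<cdot> e\<^bsub>Y\<^esub>\<close> on a module \<open>(Y, \<rho>)\<close>, for \<open>\<eta> : I \<rightarrow> RL\<close>
  and \<open>e : I \<rightarrow> LR\<close>.\<close>

definition induced_coaction ::
  "('ob, 'mb) cat \<Rightarrow> ('ob, 'mb, 'oa, 'ma) fctr \<Rightarrow> ('oa, 'ma, 'ob, 'mb) fctr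
    \<Rightarrow> ('oa \<Rightarrow> 'ma) \<Rightarrow> ('ob \<Rightarrow> 'mb) \<Rightarrow> 'ob \<Rightarrow> 'mb \<Rightarrow> 'mb" where
  "induced_coaction B R L \<eta> e Y \<rho> =
     amap (L \<circ>\<^sub>F R) \<rho> \<cdot>\<^bsub>B\<^esub> (L \<triangleright> \<eta> \<triangleleft> R) Y \<cdot>\<^bsub>B\<^esub> e Y"

end

theory Submission
  imports Defs
begin

text \<open>Write \<open>F = LR\<close>, \<open>m = L\<epsilon>tR\<close>, \<open>d = L\<eta>hR\<close>. Symmetry and idempotency of \<open>r\<close> collapse the
  endomorphism \<open>\<ell>r\<close> of \<open>F\<close> to \<open>Lr = \<ell>R = m \<cdot> F\<eta>t\<close>, and \<open>d\<close> absorbs it because \<open>\<eta>h\<close> absorbs \<open>r\<ell>\<close>.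
  What remains takes place in the category \<open>B\<close> alone: \<open>d : F \<rightarrow> FF\<close> is coassociative and linear on
  both sides over the weak monad \<open>(F, m, \<eta>t)\<close>, so the coaction \<open>\<omega> = F\<rho> \<cdot> d \<cdot> \<eta>t\<close> of a compatible
  module satisfies \<open>\<omega>\<rho> = F\<rho> \<cdot> d\<close>. This equation yields the Frobenius conditions, and composing it
  with \<open>\<eta>t\<close> recovers \<open>\<omega>\<close>, which gives uniqueness.\<close>

section \<open>Typing rules and normal forms for categories, functors and natural
  transformations\<close>

context category
begin

lemma Comp_simps [simp]:
  assumes "f \<in> Arr C" "g \<in> Arr C" "Cod C f = Dom C g"
  shows "g \<cdot> f \<in> Arr C" "Dom C (g \<cdot> f) = Dom C f" "Cod C (g \<cdot> f) = Cod C g"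
  using Comp_in_hom[of f "Dom C f" "Cod C f" g "Cod C g"] assms by (auto simp: hom_def)

lemma Id_simps [simp]:
  assumes "X \<in> Obj C"
  shows "Id C X \<in> Arr C" "Dom C (Id C X) = X" "Cod C (Id C X) = X"
  using Id_in_hom[OF assms] by (auto simp: hom_def)

lemma Obj_simps [simp]:
  assumes "f \<in> Arr C"
  shows "Dom C f \<in> Obj C" "Cod C f \<in> Obj C"
  using assms by (auto intro: Dom_in_Obj Cod_in_Obj)

lemma Comp_Id_simps [simp]:
  assumes "f \<in> Arr C"
  shows "Cod C f = X \<Longrightarrow> Id C X \<cdot> f = f" "Dom C f = X \<Longrightarrow> f \<cdot> Id C X = f"
  using Comp_Id_left[of f "Dom C f" "Cod C f"] Comp_Id_right[of f "Dom C f" "Cod C f"] assms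
  by (auto simp: hom_def)

lemma Comp_assoc_simp [simp]:
  assumes "f \<in> Arr C" "g \<in> Arr C" "h \<in> Arr C" "Cod C f = Dom C g" "Cod C g = Dom C h"
  shows "(h \<cdot> g) \<cdot> f = h \<cdot> g \<cdot> f"
  using Comp_assoc[of f "Dom C f" "Cod C f" g "Cod C g" h "Cod C h"] assms by (auto simp: hom_def)

text \<open>Composites are kept nested to the right, so an equation \<open>h \<cdot> g = k\<close>
  does not match inside a longer composite. This rule extends it by a tail \<open>f\<close>.\<close>

lemma Comp_reassoc:
  assumes "h \<cdot> g = k" "f \<in> Arr C" "g \<in> Arr C" "h \<in> Arr C" "Cod C f = Dom C g" "Cod C g = Dom C h"
  shows "h \<cdot> g \<cdot> f = k \<cdot> f"
  using Comp_assoc_simp[of f g h] assms by simp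

end

context cat_functor
begin

lemma omap_Obj [simp]: "X \<in> Obj A \<Longrightarrow> omap F X \<in> Obj B"
  by (rule omap_in_Obj)

lemma amap_simps [simp]:
  assumes "f \<in> Arr A"
  shows "amap F f \<in> Arr B" "Dom B (amap F f) = omap F (Dom A f)" "Cod B (amap F f) = omap F (Cod A f)"
  using amap_in_hom[of f "Dom A f" "Cod A f"] assms by (auto simp: hom_def)

lemma amap_Id_simp [simp]: "X \<in> Obj A \<Longrightarrow> amap F (Id A X) = Id B (omap F X)"
  by (rule amap_Id)

lemma amap_Comp_simp [simp]:
  assumes "f \<in> Arr A" "g \<in> Arr A" "Cod A f = Dom A g"
  shows "amap F (g \<cdot>\<^bsub>A\<^esub> f) = amap F g \<cdot>\<^bsub>B\<^esub> amap F f"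
  using amap_Comp[of f "Dom A f" "Cod A f" g "Cod A g"] assms by (auto simp: hom_def)

end

context nat_transf
begin

lemma component_simps [simp]:
  assumes "X \<in> Obj A"
  shows "\<tau> X \<in> Arr B" "Dom B (\<tau> X) = omap F X" "Cod B (\<tau> X) = omap G X"
  using component_in_hom[OF assms] by (auto simp: hom_def)

lemma naturality_Arr:
  assumes "f \<in> Arr A"
  shows "\<tau> (Cod A f) \<cdot>\<^bsub>B\<^esub> amap F f = amap G f \<cdot>\<^bsub>B\<^esub> \<tau> (Dom A f)"
  using naturality[of f "Dom A f" "Cod A f"] assms by (auto simp: hom_def)

end

lemma fctr_simps [simp]:
  "omap (G \<circ>\<^sub>F F) X = omap G (omap F X)" "amap (G \<circ>\<^sub>F F) f = amap G (amap F f)"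
  "omap id_fctr Y = Y" "amap id_fctr g = g"
  by (simp_all add: fctr_comp_def id_fctr_def)

lemma whisker_simps [simp]:
  "(F \<triangleright> \<tau>) X = amap F (\<tau> X)" "(\<sigma> \<triangleleft> G) Y = \<sigma> (omap G Y)" "vcomp C \<mu> \<nu> Z = \<mu> Z \<cdot>\<^bsub>C\<^esub> \<nu> Z"
  by (simp_all add: whisker_left_def whisker_right_def vcomp_def)

lemma cat_functor_id: "category C \<Longrightarrow> cat_functor C C id_fctr"
  by (simp add: cat_functor_def cat_functor_axioms_def)

lemma cat_functor_comp:
  assumes "cat_functor A B F" "cat_functor B C G"
  shows "cat_functor A C (G \<circ>\<^sub>F F)"
proof -
  interpret F: cat_functor A B F by fact
  interpret G: cat_functor B C G by fact
  show ?thesis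
    by unfold_locales (auto simp: hom_def)
qed

lemma nat_transf_vcomp:
  assumes "nat_transf A B F G \<tau>" "nat_transf A B G H \<sigma>"
  shows "nat_transf A B F H (vcomp B \<sigma> \<tau>)"
proof -
  interpret \<tau>: nat_transf A B F G \<tau> by fact
  interpret \<sigma>: nat_transf A B G H \<sigma> by fact
  show ?thesis
  proof (intro nat_transf.intro \<tau>.F.cat_functor_axioms \<sigma>.G.cat_functor_axioms nat_transf_axioms.intro)
    fix f X Y assume "f \<in> hom A X Y"
    then have [simp]: "f \<in> Arr A" "Dom A f = X" "Cod A f = Y" "X \<in> Obj A" "Y \<in> Obj A"
      by (auto simp: hom_def)
    show "vcomp B \<sigma> \<tau> Y \<cdot>\<^bsub>B\<^esub> amap F f = amap H f \<cdot>\<^bsub>B\<^esub> vcomp B \<sigma> \<tau> X"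
      using \<tau>.naturality_Arr[of f] \<tau>.F.B.Comp_reassoc[OF \<sigma>.naturality_Arr[of f], where f = "\<tau> X"]
      by simp
  qed (simp add: hom_def)
qed

section \<open>Coactions over a weak monad with a bilinear, coassociative comultiplication\<close>

locale coassociative_weak_monad = weak_monad C F m e + d: nat_transf C C F "F \<circ>\<^sub>F F" d
  for C :: "('o, 'm) cat" and F :: "('o, 'm, 'o, 'm) fctr"
    and m e d :: "'o \<Rightarrow> 'm" +
  assumes d_left_linear:
      "X \<in> Obj C \<Longrightarrow> d X \<cdot>\<^bsub>C\<^esub> m X = m (omap F X) \<cdot>\<^bsub>C\<^esub> amap F (d X)"
    and d_right_linear:
      "X \<in> Obj C \<Longrightarrow> amap F (m X) \<cdot>\<^bsub>C\<^esub> d (omap F X) = d X \<cdot>\<^bsub>C\<^esub> m X"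
    and d_coassoc:
      "X \<in> Obj C \<Longrightarrow> amap F (d X) \<cdot>\<^bsub>C\<^esub> d X = d (omap F X) \<cdot>\<^bsub>C\<^esub> d X"
    and d_compatible:
      "X \<in> Obj C \<Longrightarrow> d X \<cdot>\<^bsub>C\<^esub> m X \<cdot>\<^bsub>C\<^esub> amap F (e X) = d X"
begin

lemma nonunital_module_free:
  assumes "X \<in> Obj C"
  shows "nonunital_module C F m (omap F X) (m X)"
  using m_assoc[OF assms] assms by (simp add: nonunital_module_def hom_def)

lemma e_F_eq: "X \<in> Obj C \<Longrightarrow> m X \<cdot>\<^bsub>C\<^esub> e (omap F X) = m X \<cdot>\<^bsub>C\<^esub> amap F (e X)"
  using e_symmetric by simp

text \<open>This is \<open>induced_coaction\<close> with \<open>F\<close> for \<open>LR\<close> and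
  \<open>d\<close> for the whiskered transformation \<open>L\<eta>R\<close>.\<close>

definition coaction :: "'o \<Rightarrow> 'm \<Rightarrow> 'm" where
  "coaction X \<rho> = amap F \<rho> \<cdot>\<^bsub>C\<^esub> d X \<cdot>\<^bsub>C\<^esub> e X"

text \<open>The horizontal composite of \<open>l\<close> and \<open>r\<close> makes no sense without
  a pairing. The composite of \<open>m\<close> with \<open>F e\<close> takes its place here; for a
  symmetric regular pairing the two agree.\<close>

context
  fixes X \<rho>
  assumes mod: "compatible_module C F m (\<lambda>X. m X \<cdot>\<^bsub>C\<^esub> amap F (e X)) X \<rho>"
begin

lemma rho_simps [simp]: "X \<in> Obj C" "\<rho> \<in> Arr C" "Dom C \<rho> = omap F X" "Cod C \<rho> = X"
  using mod by (auto simp: compatible_module_def nonunital_module_def hom_def)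

lemma rho_assoc: "\<rho> \<cdot>\<^bsub>C\<^esub> amap F \<rho> = \<rho> \<cdot>\<^bsub>C\<^esub> m X"
  using mod by (auto simp: compatible_module_def nonunital_module_def)

lemma coaction_simps [simp]: "coaction X \<rho> \<in> Arr C" "Dom C (coaction X \<rho>) = X"
  "Cod C (coaction X \<rho>) = omap F X"
  by (simp_all add: coaction_def)

text \<open>Naturality of \<open>e\<close> and \<open>d\<close> moves the inner \<rho> to the left
  until it meets the outer one, and the module law replaces the pair by \<rho> and \<open>m\<close>.
  Right linearity then brings \<open>m\<close> next to \<open>e\<close>, where \<open>d\<close>
  absorbs both.\<close>

lemma coaction_action: "coaction X \<rho> \<cdot>\<^bsub>C\<^esub> \<rho> = amap F \<rho> \<cdot>\<^bsub>C\<^esub> d X"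
proof -
  have "coaction X \<rho> \<cdot>\<^bsub>C\<^esub> \<rho> = amap F \<rho> \<cdot>\<^bsub>C\<^esub> d X \<cdot>\<^bsub>C\<^esub> amap F \<rho> \<cdot>\<^bsub>C\<^esub> e (omap F X)"
    using e.naturality_Arr[of \<rho>] by (simp add: coaction_def)
  also have "\<dots> = amap F (\<rho> \<cdot>\<^bsub>C\<^esub> amap F \<rho>) \<cdot>\<^bsub>C\<^esub> d (omap F X) \<cdot>\<^bsub>C\<^esub> e (omap F X)"
    using F.A.Comp_reassoc[OF d.naturality_Arr[of \<rho>], where f = "e (omap F X)"] by simp
  also have "\<dots> = amap F \<rho> \<cdot>\<^bsub>C\<^esub> amap F (m X) \<cdot>\<^bsub>C\<^esub> d (omap F X) \<cdot>\<^bsub>C\<^esub> e (omap F X)"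
    \<comment> \<open>The module law is applied under \<open>F\<close> before functoriality splits
      the composite.\<close>
    by (simp only: rho_assoc) simp
  also have "\<dots> = amap F \<rho> \<cdot>\<^bsub>C\<^esub> d X"
    using F.A.Comp_reassoc[OF d_right_linear[of X], where f = "e (omap F X)"]
    by (simp add: e_F_eq d_compatible)
  finally show ?thesis .
qed

text \<open>Both sides equal \<open>F \<rho>\<close> after \<open>d\<close>: the left by
  \<open>coaction_action\<close>, the right by naturality of \<open>m\<close> and left linearity.
  The equation is at once the second Frobenius condition and the module morphism law for the
  coaction into the free module.\<close>

lemma coaction_linear: "coaction X \<rho> \<cdot>\<^bsub>C\<^esub> \<rho> = m X \<cdot>\<^bsub>C\<^esub> amap F (coaction X \<rho>)"
proof -
  have "m X \<cdot>\<^bsub>C\<^esub> amap F (coaction X \<rho>)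
      = amap F \<rho> \<cdot>\<^bsub>C\<^esub> m (omap F X) \<cdot>\<^bsub>C\<^esub> amap F (d X) \<cdot>\<^bsub>C\<^esub> amap F (e X)"
    using F.A.Comp_reassoc[OF m.naturality_Arr[of \<rho>], where f = "amap F (d X) \<cdot>\<^bsub>C\<^esub> amap F (e X)"]
    by (simp add: coaction_def)
  also have "\<dots> = amap F \<rho> \<cdot>\<^bsub>C\<^esub> d X"
    using F.A.Comp_reassoc[OF d_left_linear[of X, symmetric], where f = "amap F (e X)"]
    by (simp add: d_compatible)
  finally show ?thesis by (simp add: coaction_action)
qed

lemma coaction_module_morphism:
  "compatible_module_morphism C F m e X \<rho> (omap F X) (m X) (coaction X \<rho>)"
  using mod coaction_linear F.A.Comp_reassoc[OF coaction_action, where f = "e X"]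
  by (simp add: compatible_module_morphism_def module_morphism_def nonunital_module_free
      compatible_module_def hom_def) (simp add: coaction_def)

text \<open>By \<open>coaction_action\<close> the square of the coaction contains \<open>F d\<close>
  after \<open>d\<close>; coassociativity of \<open>d\<close> exchanges the two layers and
  naturality at \<rho> restores one coaction.\<close>

lemma coaction_coassoc: "noncounital_comodule C F d X (coaction X \<rho>)"
proof -
  have "amap F (coaction X \<rho>) \<cdot>\<^bsub>C\<^esub> coaction X \<rho> = amap F (coaction X \<rho> \<cdot>\<^bsub>C\<^esub> \<rho>) \<cdot>\<^bsub>C\<^esub> d X \<cdot>\<^bsub>C\<^esub> e X"
    \<comment> \<open>Only the right factor is unfolded, so that the intact left one meets
      \<rho>.\<close>
    by (subst (2) coaction_def) simp
  also have "\<dots> = amap F (amap F \<rho>) \<cdot>\<^bsub>C\<^esub> d (omap F X) \<cdot>\<^bsub>C\<^esub> d X \<cdot>\<^bsub>C\<^esub> e X"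
    using F.A.Comp_reassoc[OF d_coassoc[of X], where f = "e X"] by (simp only: coaction_action) simp
  also have "\<dots> = d X \<cdot>\<^bsub>C\<^esub> coaction X \<rho>"
    using F.A.Comp_reassoc[OF d.naturality_Arr[of \<rho>], where f = "d X \<cdot>\<^bsub>C\<^esub> e X"]
    by (simp add: coaction_def)
  finally show ?thesis by (simp add: noncounital_comodule_def hom_def)
qed

text \<open>The first premise is one of the Frobenius conditions, the last is compatibility of
  \<omega> as a module morphism. Precomposing the first with \<open>e X\<close> turns its left side
  into the coaction and its right side into \<omega>.\<close>

lemma coaction_unique:
  assumes "amap F \<rho> \<cdot>\<^bsub>C\<^esub> d X = \<omega> \<cdot>\<^bsub>C\<^esub> \<rho>" "\<omega> \<in> hom C X (omap F X)" "\<omega> \<cdot>\<^bsub>C\<^esub> \<rho> \<cdot>\<^bsub>C\<^esub> e X = \<omega>"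
  shows "\<omega> = coaction X \<rho>"
  using F.A.Comp_reassoc[OF assms(1), where f = "e X"] assms by (simp add: coaction_def hom_def)

end

text \<open>Linearity carries \<open>h\<close> past the actions, and naturality of \<open>d\<close>
  and \<open>e\<close> carries it the rest of the way.\<close>

lemma comodule_morphism_coaction:
  assumes X: "compatible_module C F m (\<lambda>X. m X \<cdot>\<^bsub>C\<^esub> amap F (e X)) X \<rho>"
    and Y: "compatible_module C F m (\<lambda>X. m X \<cdot>\<^bsub>C\<^esub> amap F (e X)) Y \<sigma>"
    and h: "module_morphism C F m X \<rho> Y \<sigma> h"
  shows "comodule_morphism C F d X (coaction X \<rho>) Y (coaction Y \<sigma>) h"
proof -
  note [simp] = rho_simps[OF X] rho_simps[OF Y]
  have h' [simp]: "h \<in> Arr C" "Dom C h = X" "Cod C h = Y" and lin: "h \<cdot>\<^bsub>C\<^esub> \<rho> = \<sigma> \<cdot>\<^bsub>C\<^esub> amap F h"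
    using h by (auto simp: module_morphism_def hom_def)
  have "amap F h \<cdot>\<^bsub>C\<^esub> coaction X \<rho> = amap F (h \<cdot>\<^bsub>C\<^esub> \<rho>) \<cdot>\<^bsub>C\<^esub> d X \<cdot>\<^bsub>C\<^esub> e X"
    by (simp add: coaction_def)
  also have "\<dots> = amap F \<sigma> \<cdot>\<^bsub>C\<^esub> d Y \<cdot>\<^bsub>C\<^esub> amap F h \<cdot>\<^bsub>C\<^esub> e X"
    using F.A.Comp_reassoc[OF d.naturality_Arr[of h], where f = "e X"] by (simp only: lin) simp
  also have "\<dots> = coaction Y \<sigma> \<cdot>\<^bsub>C\<^esub> h"
    using e.naturality_Arr[of h] by (simp add: coaction_def)
  finally show ?thesis
    using coaction_coassoc[OF X] coaction_coassoc[OF Y] by (simp add: comodule_morphism_def hom_def)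
qed

end

section \<open>Unit, counit and the endomorphisms \<open>r\<close> and \<open>l\<close> of a
  pairing\<close>

context pairing
begin

abbreviation (input) "unit \<equiv> pairing_unit A R \<alpha>"
abbreviation (input) "counit \<equiv> pairing_counit B L \<beta>"

text \<open>Yoneda argument: naturality determines \<alpha> by its value at an identity, which is
  the unit.\<close>

lemma alpha_eq:
  assumes "Y \<in> Obj B" "f \<in> Arr A" "Dom A f = omap R Y" "Cod A f = X"
  shows "\<alpha> Y X f = amap L f \<cdot>\<^bsub>B\<^esub> unit Y"
proof -
  have "unit Y \<in> hom B Y (omap L (omap R Y))"
    unfolding pairing_unit_def using assms by (auto intro!: alpha_in_hom L.A.Id_in_hom)
  then show ?thesis
    using alpha_natural[of "Id B Y" Y Y f "omap R Y" X "Id A (omap R Y)"] assms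
    by (simp add: hom_def pairing_unit_def)
qed

lemma beta_eq:
  assumes "X \<in> Obj A" "g \<in> Arr B" "Dom B g = Y" "Cod B g = omap L X"
  shows "\<beta> Y X g = counit X \<cdot>\<^bsub>A\<^esub> amap R g"
proof -
  have "counit X \<in> hom A (omap R (omap L X)) X"
    unfolding pairing_counit_def using assms by (auto intro!: beta_in_hom L.B.Id_in_hom)
  then show ?thesis
    using beta_natural[of g Y "omap L X" "Id A X" X X "Id B (omap L X)"] assms
    by (simp add: hom_def pairing_counit_def)
qed

text \<open>The value of \<alpha> at \<open>amap R k\<close> is computed twice: naturality in the
  \<open>B\<close> argument gives one side of the square, \<open>alpha_eq\<close> the other. The
  counit is treated dually, with \<beta> at \<open>amap L k\<close>.\<close>

lemma nat_transf_unit: "nat_transf B B id_fctr (L \<circ>\<^sub>F R) unit"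
proof -
  have hom: "unit Y \<in> hom B Y (omap L (omap R Y))" if "Y \<in> Obj B" for Y
    unfolding pairing_unit_def using that by (auto intro!: alpha_in_hom L.A.Id_in_hom)
  have nat: "unit Y \<cdot>\<^bsub>B\<^esub> k = amap L (amap R k) \<cdot>\<^bsub>B\<^esub> unit X" if "k \<in> hom B X Y" for k X Y
  proof -
    have [simp]: "k \<in> Arr B" "Dom B k = X" "Cod B k = Y" "X \<in> Obj B" "Y \<in> Obj B"
      using that by (auto simp: hom_def)
    have [simp]: "unit Y \<in> Arr B" "Dom B (unit Y) = Y" "Cod B (unit Y) = omap L (omap R Y)"
      using hom[of Y] by (auto simp: hom_def)
    show ?thesis
      using alpha_natural[of k X Y "Id A (omap R Y)" "omap R Y" "omap R Y" "Id A (omap R Y)"]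
        alpha_eq[of X "amap R k" "omap R Y"]
      by (simp add: hom_def flip: fun_cong[OF pairing_unit_def[of A R \<alpha>]])
  qed
  show ?thesis
    by (intro nat_transf.intro cat_functor_id cat_functor_comp[OF R.cat_functor_axioms]
        L.cat_functor_axioms L.B.category_axioms nat_transf_axioms.intro) (use hom nat in auto)
qed

lemma nat_transf_counit: "nat_transf A A (R \<circ>\<^sub>F L) id_fctr counit"
proof -
  have hom: "counit X \<in> hom A (omap R (omap L X)) X" if "X \<in> Obj A" for X
    unfolding pairing_counit_def using that by (auto intro!: beta_in_hom L.B.Id_in_hom)
  have nat: "counit Y \<cdot>\<^bsub>A\<^esub> amap R (amap L k) = k \<cdot>\<^bsub>A\<^esub> counit X" if "k \<in> hom A X Y" for k X Y
  proof -
    have [simp]: "k \<in> Arr A" "Dom A k = X" "Cod A k = Y" "X \<in> Obj A" "Y \<in> Obj A"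
      using that by (auto simp: hom_def)
    have [simp]: "counit X \<in> Arr A" "Dom A (counit X) = omap R (omap L X)" "Cod A (counit X) = X"
      using hom[of X] by (auto simp: hom_def)
    show ?thesis
      using beta_natural[of "Id B (omap L X)" "omap L X" "omap L X" k X Y "Id B (omap L X)"]
        beta_eq[of Y "amap L k" "omap L X"]
      by (simp add: hom_def flip: fun_cong[OF pairing_counit_def[of B L \<beta>]])
  qed
  show ?thesis
    by (intro nat_transf.intro cat_functor_id cat_functor_comp[OF L.cat_functor_axioms]
        R.cat_functor_axioms L.A.category_axioms nat_transf_axioms.intro) (use hom nat in auto)
qed

sublocale unit: nat_transf B B id_fctr "L \<circ>\<^sub>F R" unit
  by (rule nat_transf_unit)

sublocale counit: nat_transf A A "R \<circ>\<^sub>F L" id_fctr counit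
  by (rule nat_transf_counit)

abbreviation (input) "r \<equiv> pairing_r A R unit counit"
abbreviation (input) "l \<equiv> pairing_l B L unit counit"

lemma r_eq: "r Y = counit (omap R Y) \<cdot>\<^bsub>A\<^esub> amap R (unit Y)"
  by (simp add: pairing_r_def)

lemma l_eq: "l X = amap L (counit X) \<cdot>\<^bsub>B\<^esub> unit (omap L X)"
  by (simp add: pairing_l_def)

lemma nat_transf_r: "nat_transf B A R R r"
proof (intro nat_transf.intro R.cat_functor_axioms nat_transf_axioms.intro)
  fix f X Y assume "f \<in> hom B X Y"
  then have [simp]: "f \<in> Arr B" "Dom B f = X" "Cod B f = Y" "X \<in> Obj B" "Y \<in> Obj B"
    by (auto simp: hom_def)
  have "r Y \<cdot>\<^bsub>A\<^esub> amap R f = counit (omap R Y) \<cdot>\<^bsub>A\<^esub> amap R (unit Y \<cdot>\<^bsub>B\<^esub> f)"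
    by (simp add: r_eq)
  also have "\<dots> = counit (omap R Y) \<cdot>\<^bsub>A\<^esub> amap R (amap L (amap R f)) \<cdot>\<^bsub>A\<^esub> amap R (unit X)"
    using unit.naturality_Arr[of f] by simp
  also have "\<dots> = amap R f \<cdot>\<^bsub>A\<^esub> r X"
    using L.A.Comp_reassoc[OF counit.naturality_Arr[of "amap R f"], where f = "amap R (unit X)"]
    by (simp add: r_eq)
  finally show "r Y \<cdot>\<^bsub>A\<^esub> amap R f = amap R f \<cdot>\<^bsub>A\<^esub> r X" .
qed (simp add: hom_def r_eq)

lemma nat_transf_l: "nat_transf A B L L l"
proof (intro nat_transf.intro L.cat_functor_axioms nat_transf_axioms.intro)
  fix f X Y assume "f \<in> hom A X Y"
  then have [simp]: "f \<in> Arr A" "Dom A f = X" "Cod A f = Y" "X \<in> Obj A" "Y \<in> Obj A"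
    by (auto simp: hom_def)
  have "l Y \<cdot>\<^bsub>B\<^esub> amap L f = amap L (counit Y \<cdot>\<^bsub>A\<^esub> amap R (amap L f)) \<cdot>\<^bsub>B\<^esub> unit (omap L X)"
    using unit.naturality_Arr[of "amap L f"] by (simp add: l_eq)
  also have "\<dots> = amap L f \<cdot>\<^bsub>B\<^esub> l X"
    using counit.naturality_Arr[of f] by (simp add: l_eq)
  finally show "l Y \<cdot>\<^bsub>B\<^esub> amap L f = amap L f \<cdot>\<^bsub>B\<^esub> l X" .
qed (simp add: hom_def l_eq)

sublocale r: nat_transf B A R R r
  by (rule nat_transf_r)

sublocale l: nat_transf A B L L l
  by (rule nat_transf_l)

end

section \<open>Regularity: absorption laws and idempotents\<close>

context regular_pairing
begin

text \<open>Regularity of \<alpha> is evaluated at an identity, with \<alpha> and \<beta> rewritten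
  through unit and counit. The next lemma is the dual for \<beta>.\<close>

lemma L_r_unit: "Y \<in> Obj B \<Longrightarrow> amap L (r Y) \<cdot>\<^bsub>B\<^esub> unit Y = unit Y"
  using alpha_regular[of Y "omap R Y" "Id A (omap R Y)"]
  by (simp add: hom_def r_eq alpha_eq beta_eq)

lemma counit_R_l: "X \<in> Obj A \<Longrightarrow> counit X \<cdot>\<^bsub>A\<^esub> amap R (l X) = counit X"
  using beta_regular[of "omap L X" X "Id B (omap L X)"]
  by (simp add: hom_def l_eq alpha_eq beta_eq)

text \<open>Naturality of the counit at \<open>r Y\<close> pulls the left factor into the argument
  of \<open>R\<close>, where the unit absorbs it by \<open>L_r_unit\<close>.\<close>

lemma r_idem:
  assumes [simp]: "Y \<in> Obj B"
  shows "r Y \<cdot>\<^bsub>A\<^esub> r Y = r Y"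
proof -
  have "r Y \<cdot>\<^bsub>A\<^esub> r Y = counit (omap R Y) \<cdot>\<^bsub>A\<^esub> amap R (amap L (r Y) \<cdot>\<^bsub>B\<^esub> unit Y)"
    using L.A.Comp_reassoc[OF counit.naturality_Arr[of "r Y"], where f = "amap R (unit Y)"]
    by (simp add: r_eq[symmetric])
  then show ?thesis
    by (simp only: L_r_unit[OF assms] r_eq[symmetric])
qed

lemma l_idem:
  assumes [simp]: "X \<in> Obj A"
  shows "l X \<cdot>\<^bsub>B\<^esub> l X = l X"
proof -
  have "l X \<cdot>\<^bsub>B\<^esub> l X = amap L (counit X \<cdot>\<^bsub>A\<^esub> amap R (l X)) \<cdot>\<^bsub>B\<^esub> unit (omap L X)"
    using unit.naturality_Arr[of "l X"]
    by (subst l_eq) simp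
  then show ?thesis
    by (simp only: counit_R_l[OF assms] l_eq[symmetric])
qed

abbreviation (input) "rl \<equiv> hcomp A R L r l"

lemma rl_eq: "rl X = r (omap L X) \<cdot>\<^bsub>A\<^esub> amap R (l X)"
  by (simp add: hcomp_def)

text \<open>Naturality of \<open>r\<close> at \<open>l X\<close> makes the two idempotent factors of
  \<open>rl\<close> commute.\<close>

lemma rl_idem:
  assumes [simp]: "X \<in> Obj A"
  shows "rl X \<cdot>\<^bsub>A\<^esub> rl X = rl X"
proof -
  have "rl X \<cdot>\<^bsub>A\<^esub> rl X = (r (omap L X) \<cdot>\<^bsub>A\<^esub> r (omap L X)) \<cdot>\<^bsub>A\<^esub> amap R (l X \<cdot>\<^bsub>B\<^esub> l X)"
    using L.A.Comp_reassoc[OF r.naturality_Arr[of "l X", symmetric], where f = "amap R (l X)"]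
    by (simp add: rl_eq)
  then show ?thesis
    by (simp only: r_idem l_idem L.omap_Obj assms rl_eq)
qed

lemma R_l_rl:
  assumes [simp]: "X \<in> Obj A"
  shows "amap R (l X) \<cdot>\<^bsub>A\<^esub> rl X = rl X"
proof -
  have "amap R (l X) \<cdot>\<^bsub>A\<^esub> rl X = r (omap L X) \<cdot>\<^bsub>A\<^esub> amap R (l X \<cdot>\<^bsub>B\<^esub> l X)"
    using L.A.Comp_reassoc[OF r.naturality_Arr[of "l X", symmetric], where f = "amap R (l X)"]
    by (simp add: rl_eq)
  then show ?thesis
    by (simp only: l_idem assms rl_eq)
qed

lemma nat_transf_rl: "nat_transf A A (R \<circ>\<^sub>F L) (R \<circ>\<^sub>F L) rl"
proof (intro nat_transf.intro counit.F.cat_functor_axioms nat_transf_axioms.intro)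
  fix f X Y assume "f \<in> hom A X Y"
  then have [simp]: "f \<in> Arr A" "Dom A f = X" "Cod A f = Y" "X \<in> Obj A" "Y \<in> Obj A"
    by (auto simp: hom_def)
  have "rl Y \<cdot>\<^bsub>A\<^esub> amap R (amap L f) = r (omap L Y) \<cdot>\<^bsub>A\<^esub> amap R (l Y \<cdot>\<^bsub>B\<^esub> amap L f)"
    by (simp add: rl_eq)
  also have "\<dots> = amap R (amap L f) \<cdot>\<^bsub>A\<^esub> rl X"
    using L.A.Comp_reassoc[OF r.naturality_Arr[of "amap L f"], where f = "amap R (l X)"]
      l.naturality_Arr[of f] by (simp add: rl_eq)
  finally show "rl Y \<cdot>\<^bsub>A\<^esub> amap (R \<circ>\<^sub>F L) f = amap (R \<circ>\<^sub>F L) f \<cdot>\<^bsub>A\<^esub> rl X"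
    by simp
qed (simp add: hom_def rl_eq)

end

section \<open>Symmetry of \<alpha> and the weak monad on \<open>LR\<close>\<close>

locale symmetric_regular_pairing = regular_pairing A B R L \<alpha> \<beta>
  for A :: "('oa, 'ma) cat" and B :: "('ob, 'mb) cat"
    and R :: "('ob, 'mb, 'oa, 'ma) fctr" and L :: "('oa, 'ma, 'ob, 'mb) fctr"
    and \<alpha> :: "'ob \<Rightarrow> 'oa \<Rightarrow> 'ma \<Rightarrow> 'mb" and \<beta> :: "'ob \<Rightarrow> 'oa \<Rightarrow> 'mb \<Rightarrow> 'ma" +
  assumes symmetric: "symmetric_alpha A B R L \<alpha> \<beta>"
begin

lemma L_r_eq_l_R: "Y \<in> Obj B \<Longrightarrow> amap L (r Y) = l (omap R Y)"
  using symmetric by (simp add: symmetric_alpha_def Let_def)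

text \<open>By symmetry both factors of the horizontal composite are \<open>L r\<close>, and
  \<open>r\<close> is idempotent.\<close>

lemma lr_eq:
  assumes [simp]: "Y \<in> Obj B"
  shows "hcomp B L R l r Y = amap L (r Y)"
proof -
  have "hcomp B L R l r Y = amap L (r Y \<cdot>\<^bsub>A\<^esub> r Y)"
    by (simp add: hcomp_def L_r_eq_l_R)
  then show ?thesis
    by (simp only: r_idem assms)
qed

text \<open>The right side is \<open>m\<close> after \<open>F\<close> of the unit, for
  \<open>F = LR\<close> and \<open>m\<close> the multiplication; this links \<open>L r\<close> to
  the weak monad axioms.\<close>

lemma L_r_expand:
  assumes [simp]: "Y \<in> Obj B"
  shows "amap L (r Y) = amap L (counit (omap R Y)) \<cdot>\<^bsub>B\<^esub> amap L (amap R (unit Y))"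
  by (simp add: r_eq)

text \<open>Naturality of the counit at \<open>r Y\<close> produces \<open>R L r\<close>, which
  symmetry turns into \<open>R l\<close>; the counit absorbs that by regularity of \<beta>.\<close>

lemma r_counit_R:
  assumes [simp]: "Y \<in> Obj B"
  shows "r Y \<cdot>\<^bsub>A\<^esub> counit (omap R Y) = counit (omap R Y)"
  using counit.naturality_Arr[of "r Y"] counit_R_l[of "omap R Y"] by (simp add: L_r_eq_l_R)

lemma L_counit_l:
  assumes [simp]: "Y \<in> Obj B"
  shows "amap L (counit (omap R Y)) \<cdot>\<^bsub>B\<^esub> l (omap R (omap L (omap R Y))) = amap L (counit (omap R Y))"
proof -
  have "amap L (counit (omap R Y)) \<cdot>\<^bsub>B\<^esub> l (omap R (omap L (omap R Y)))
      = amap L (r Y \<cdot>\<^bsub>A\<^esub> counit (omap R Y))"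
    using l.naturality_Arr[of "counit (omap R Y)"] by (simp add: L_r_eq_l_R)
  then show ?thesis
    by (simp only: r_counit_R assms)
qed

text \<open>Naturality and associativity of the multiplication are images under \<open>L\<close> of
  naturality squares of the counit. Regularity of the unit is \<open>L_r_unit\<close>, its symmetry
  is the equation of \<open>L r\<close> with \<open>l R\<close>, and compatibility of the
  multiplication is \<open>L_counit_l\<close>.\<close>

lemma weak_monad_LR: "weak_monad B (L \<circ>\<^sub>F R) (L \<triangleright> counit \<triangleleft> R) unit"
proof (intro weak_monad.intro unit.nat_transf_axioms unit.G.cat_functor_axioms
    weak_monad_axioms.intro nat_transf.intro nat_transf_axioms.intro
    cat_functor_comp[OF unit.G.cat_functor_axioms unit.G.cat_functor_axioms])
  fix f X Y assume "f \<in> hom B X Y"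
  then have [simp]: "f \<in> Arr B" "Dom B f = X" "Cod B f = Y" "X \<in> Obj B" "Y \<in> Obj B"
    by (auto simp: hom_def)
  show "(L \<triangleright> counit \<triangleleft> R) Y \<cdot>\<^bsub>B\<^esub> amap ((L \<circ>\<^sub>F R) \<circ>\<^sub>F (L \<circ>\<^sub>F R)) f
      = amap (L \<circ>\<^sub>F R) f \<cdot>\<^bsub>B\<^esub> (L \<triangleright> counit \<triangleleft> R) X"
    using arg_cong[OF counit.naturality_Arr[of "amap R f"], where f = "amap L"] by simp
next
  fix Y assume [simp]: "Y \<in> Obj B"
  show "vcomp B (L \<triangleright> counit \<triangleleft> R) ((L \<circ>\<^sub>F R) \<triangleright> (L \<triangleright> counit \<triangleleft> R)) Y
      = vcomp B (L \<triangleright> counit \<triangleleft> R) (L \<triangleright> counit \<triangleleft> R \<triangleleft> (L \<circ>\<^sub>F R)) Y"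
    using arg_cong[OF counit.naturality_Arr[of "counit (omap R Y)"], where f = "amap L"] by simp
  show "unit Y = vcomp B (L \<triangleright> counit \<triangleleft> R) (vcomp B ((L \<circ>\<^sub>F R) \<triangleright> unit) unit) Y"
    using L_r_unit[of Y] by (simp add: L_r_expand)
  show "vcomp B (L \<triangleright> counit \<triangleleft> R) ((L \<circ>\<^sub>F R) \<triangleright> unit) Y
      = vcomp B (L \<triangleright> counit \<triangleleft> R) (unit \<triangleleft> (L \<circ>\<^sub>F R)) Y"
    using L_r_eq_l_R[of Y] by (simp add: L_r_expand l_eq)
  show "(L \<triangleright> counit \<triangleleft> R) Y
      = vcomp B (L \<triangleright> counit \<triangleleft> R)
          (vcomp B (L \<triangleright> counit \<triangleleft> R \<triangleleft> (L \<circ>\<^sub>F R)) ((L \<circ>\<^sub>F R) \<triangleright> unit \<triangleleft> (L \<circ>\<^sub>F R))) Y"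
    using L_counit_l[of Y] L_r_expand[of "omap L (omap R Y)"]
    by (simp flip: L_r_eq_l_R)
qed (simp add: hom_def)

section \<open>The comultiplication given by a transformation \<eta> that absorbs
  \<open>rl\<close>\<close>

context
  fixes \<eta>
  assumes \<eta>: "nat_transf A A id_fctr (R \<circ>\<^sub>F L) \<eta>"
    and \<eta>_rl: "\<And>X. X \<in> Obj A \<Longrightarrow> rl X \<cdot>\<^bsub>A\<^esub> \<eta> X = \<eta> X"
begin

interpretation \<eta>: nat_transf A A id_fctr "R \<circ>\<^sub>F L" \<eta> by (rule \<eta>)

interpretation rl: nat_transf A A "R \<circ>\<^sub>F L" "R \<circ>\<^sub>F L" rl by (rule nat_transf_rl)

text \<open>Naturality moves \<open>r\<close> across \<eta>, where symmetry makes it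
  \<open>R l\<close>. Since \<eta> factors through \<open>rl\<close>, and \<open>rl\<close> absorbs
  \<open>R l\<close>, nothing is left of it.\<close>

lemma \<eta>_R_r:
  assumes [simp]: "Y \<in> Obj B"
  shows "\<eta> (omap R Y) \<cdot>\<^bsub>A\<^esub> r Y = \<eta> (omap R Y)"
proof -
  have "\<eta> (omap R Y) \<cdot>\<^bsub>A\<^esub> r Y = amap R (l (omap R Y)) \<cdot>\<^bsub>A\<^esub> rl (omap R Y) \<cdot>\<^bsub>A\<^esub> \<eta> (omap R Y)"
    using \<eta>.naturality_Arr[of "r Y"] by (simp add: L_r_eq_l_R \<eta>_rl)
  then show ?thesis
    using L.A.Comp_reassoc[OF R_l_rl[of "omap R Y"], where f = "\<eta> (omap R Y)"] by (simp add: \<eta>_rl)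
qed

text \<open>Each linearity law and coassociativity is the image under \<open>L\<close> of one
  naturality square: the counit at \<eta>, \<eta> at the counit, and \<eta> at itself. Compatibility
  is the image of \<open>\<eta>_R_r\<close>.\<close>

lemma coassociative_weak_monad_LR:
  "coassociative_weak_monad B (L \<circ>\<^sub>F R) (L \<triangleright> counit \<triangleleft> R) unit (L \<triangleright> \<eta> \<triangleleft> R)"
proof (intro coassociative_weak_monad.intro weak_monad_LR coassociative_weak_monad_axioms.intro
    nat_transf.intro unit.G.cat_functor_axioms
    cat_functor_comp[OF unit.G.cat_functor_axioms unit.G.cat_functor_axioms] nat_transf_axioms.intro)
  fix f X Y assume "f \<in> hom B X Y"
  then have [simp]: "f \<in> Arr B" "Dom B f = X" "Cod B f = Y" "X \<in> Obj B" "Y \<in> Obj B"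
    by (auto simp: hom_def)
  show "(L \<triangleright> \<eta> \<triangleleft> R) Y \<cdot>\<^bsub>B\<^esub> amap (L \<circ>\<^sub>F R) f
      = amap ((L \<circ>\<^sub>F R) \<circ>\<^sub>F (L \<circ>\<^sub>F R)) f \<cdot>\<^bsub>B\<^esub> (L \<triangleright> \<eta> \<triangleleft> R) X"
    using arg_cong[OF \<eta>.naturality_Arr[of "amap R f"], where f = "amap L"] by simp
next
  fix Y assume [simp]: "Y \<in> Obj B"
  show "(L \<triangleright> \<eta> \<triangleleft> R) Y \<cdot>\<^bsub>B\<^esub> (L \<triangleright> counit \<triangleleft> R) Y
      = (L \<triangleright> counit \<triangleleft> R) (omap (L \<circ>\<^sub>F R) Y) \<cdot>\<^bsub>B\<^esub> amap (L \<circ>\<^sub>F R) ((L \<triangleright> \<eta> \<triangleleft> R) Y)"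
    using arg_cong[OF counit.naturality_Arr[of "\<eta> (omap R Y)"], where f = "amap L"] by simp
  show "amap (L \<circ>\<^sub>F R) ((L \<triangleright> counit \<triangleleft> R) Y) \<cdot>\<^bsub>B\<^esub> (L \<triangleright> \<eta> \<triangleleft> R) (omap (L \<circ>\<^sub>F R) Y)
      = (L \<triangleright> \<eta> \<triangleleft> R) Y \<cdot>\<^bsub>B\<^esub> (L \<triangleright> counit \<triangleleft> R) Y"
    using arg_cong[OF \<eta>.naturality_Arr[of "counit (omap R Y)"], where f = "amap L"] by simp
  show "amap (L \<circ>\<^sub>F R) ((L \<triangleright> \<eta> \<triangleleft> R) Y) \<cdot>\<^bsub>B\<^esub> (L \<triangleright> \<eta> \<triangleleft> R) Y
      = (L \<triangleright> \<eta> \<triangleleft> R) (omap (L \<circ>\<^sub>F R) Y) \<cdot>\<^bsub>B\<^esub> (L \<triangleright> \<eta> \<triangleleft> R) Y"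
    using arg_cong[OF \<eta>.naturality_Arr[of "\<eta> (omap R Y)"], where f = "amap L"] by simp
  show "(L \<triangleright> \<eta> \<triangleleft> R) Y \<cdot>\<^bsub>B\<^esub> (L \<triangleright> counit \<triangleleft> R) Y \<cdot>\<^bsub>B\<^esub> amap (L \<circ>\<^sub>F R) (unit Y) = (L \<triangleright> \<eta> \<triangleleft> R) Y"
    using arg_cong[OF \<eta>_R_r[of Y], where f = "amap L"] by (simp add: L_r_expand)
qed (simp add: hom_def)

end

end

section \<open>Transfer of the coaction results to the pairing\<close>

theorem theorem3p10:
  fixes A :: "('oa, 'ma) cat" and B :: "('ob, 'mb) cat"
    and R :: "('ob, 'mb, 'oa, 'ma) fctr" and L :: "('oa, 'ma, 'ob, 'mb) fctr"
    and \<alpha> :: "'ob \<Rightarrow> 'oa \<Rightarrow> 'ma \<Rightarrow> 'mb" and \<beta> :: "'ob \<Rightarrow> 'oa \<Rightarrow> 'mb \<Rightarrow> 'ma"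
    and \<eta> :: "'oa \<Rightarrow> 'ma"
    and \<eta>t :: "'ob \<Rightarrow> 'mb" and \<epsilon>t :: "'oa \<Rightarrow> 'ma" and r :: "'ob \<Rightarrow> 'ma" and l :: "'oa \<Rightarrow> 'mb"
    and lr :: "'ob \<Rightarrow> 'mb" and rl :: "'oa \<Rightarrow> 'ma" and \<eta>h :: "'oa \<Rightarrow> 'ma"
    and LR :: "('ob, 'mb, 'ob, 'mb) fctr" and m :: "'ob \<Rightarrow> 'mb"
  assumes "regular_pairing A B R L \<alpha> \<beta>"
    and "symmetric_alpha A B R L \<alpha> \<beta>"
    and "nat_transf A A id_fctr (R \<circ>\<^sub>F L) \<eta>"
    and \<eta>t: "\<eta>t = pairing_unit A R \<alpha>" and \<epsilon>t: "\<epsilon>t = pairing_counit B L \<beta>"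
    and r: "r = pairing_r A R \<eta>t \<epsilon>t" and l: "l = pairing_l B L \<eta>t \<epsilon>t"
    and lr: "lr = hcomp B L R l r" and rl: "rl = hcomp A R L r l"
    and \<eta>h: "\<eta>h = vcomp A rl \<eta>"
    and LR: "LR = L \<circ>\<^sub>F R" and m: "m = L \<triangleright> \<epsilon>t \<triangleleft> R"
  shows
    "(nat_transf A A id_fctr (R \<circ>\<^sub>F L) \<eta>h \<and>
      (\<forall>X \<in> Obj A. \<eta>h X = vcomp A rl \<eta>h X) \<and>
      (\<forall>Y \<in> Obj B. (L \<triangleright> \<eta>h \<triangleleft> R) Y = vcomp B (L \<triangleright> \<eta>h \<triangleleft> R) lr Y) \<and>
      (\<forall>Y \<in> Obj B. compatible_module_morphism B LR m \<eta>t
         (omap LR Y) (m Y) (omap LR (omap LR Y)) (m (omap LR Y)) ((L \<triangleright> \<eta>h \<triangleleft> R) Y)))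
   \<and>
     (weak_monad B LR m \<eta>t \<and>
      (\<forall>Y \<rho>. compatible_module B LR m lr Y \<rho> \<longrightarrow>
        (let is_frobenius_coaction = (\<lambda>\<omega>.
           compatible_module_morphism B LR m \<eta>t Y \<rho> (omap LR Y) (m Y) \<omega> \<and>
           frobenius_bimodule B R L \<eta>h \<epsilon>t Y \<rho> \<omega>)
         in (\<exists>!\<omega>. is_frobenius_coaction \<omega>) \<and>
            is_frobenius_coaction (induced_coaction B R L \<eta>h \<eta>t Y \<rho>))))
   \<and>
     (\<forall>Y \<rho> Y' \<rho>' h.
        compatible_module B LR m lr Y \<rho> \<and> compatible_module B LR m lr Y' \<rho>' \<and>
        module_morphism B LR m Y \<rho> Y' \<rho>' h \<longrightarrow>
        bimodule_morphism B R L \<eta>h \<epsilon>t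
          Y \<rho> (induced_coaction B R L \<eta>h \<eta>t Y \<rho>)
          Y' \<rho>' (induced_coaction B R L \<eta>h \<eta>t Y' \<rho>') h)"
proof -
  interpret symmetric_regular_pairing A B R L \<alpha> \<beta>
    using assms(1,2) by (simp add: symmetric_regular_pairing_def symmetric_regular_pairing_axioms_def)
  interpret \<eta>: nat_transf A A id_fctr "R \<circ>\<^sub>F L" \<eta> by fact
  interpret rl: nat_transf A A "R \<circ>\<^sub>F L" "R \<circ>\<^sub>F L" rl
    unfolding rl r l \<eta>t \<epsilon>t by (rule nat_transf_rl)
  have nat: "nat_transf A A id_fctr (R \<circ>\<^sub>F L) \<eta>h"
    unfolding \<eta>h by (rule nat_transf_vcomp) unfold_locales
  have rl_idem': "rl X \<cdot>\<^bsub>A\<^esub> rl X = rl X" if "X \<in> Obj A" for X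
    using rl_idem[OF that] by (simp only: rl r l \<eta>t \<epsilon>t)
  \<comment> \<open>Idempotency of \<open>rl\<close> gives the absorption hypothesis under which
    \<open>L\<eta>hR\<close> is a comultiplication.\<close>
  have inv: "rl X \<cdot>\<^bsub>A\<^esub> \<eta>h X = \<eta>h X" if [simp]: "X \<in> Obj A" for X
    using L.A.Comp_reassoc[OF rl_idem'[of X], where f = "\<eta> X"] by (simp add: \<eta>h)
  interpret M: coassociative_weak_monad B LR m \<eta>t "L \<triangleright> \<eta>h \<triangleleft> R"
    unfolding LR m \<eta>t \<epsilon>t
    by (rule coassociative_weak_monad_LR[OF nat]) (use inv in \<open>simp add: rl r l \<eta>t \<epsilon>t\<close>)
  have lr': "lr Y = m Y \<cdot>\<^bsub>B\<^esub> amap LR (\<eta>t Y)" if "Y \<in> Obj B" for Y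
    using lr_eq[OF that] L_r_expand[OF that] by (simp add: lr l r \<eta>t \<epsilon>t m LR)
  \<comment> \<open>The two endomorphisms agree at objects, and a module lives on an object, so both
    notions of compatibility coincide.\<close>
  have compat: "compatible_module B LR m lr Y \<rho>
      \<longleftrightarrow> compatible_module B LR m (\<lambda>X. m X \<cdot>\<^bsub>B\<^esub> amap LR (\<eta>t X)) Y \<rho>" for Y \<rho>
    by (auto simp: compatible_module_def nonunital_module_def lr')
  have coact: "induced_coaction B R L \<eta>h \<eta>t Y \<rho> = M.coaction Y \<rho>" for Y \<rho>
    by (simp only: induced_coaction_def M.coaction_def flip: LR)
  have frob: "frobenius_bimodule B R L \<eta>h \<epsilon>t Y \<rho> \<omega> \<longleftrightarrow>
      nonunital_module B LR m Y \<rho> \<and> noncounital_comodule B LR (L \<triangleright> \<eta>h \<triangleleft> R) Y \<omega> \<and>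
      amap LR \<rho> \<cdot>\<^bsub>B\<^esub> (L \<triangleright> \<eta>h \<triangleleft> R) Y = \<omega> \<cdot>\<^bsub>B\<^esub> \<rho> \<and> \<omega> \<cdot>\<^bsub>B\<^esub> \<rho> = m Y \<cdot>\<^bsub>B\<^esub> amap LR \<omega>" for Y \<rho> \<omega>
    by (simp only: frobenius_bimodule_def LR m)
  have frob_coact: "frobenius_bimodule B R L \<eta>h \<epsilon>t Y \<rho> (M.coaction Y \<rho>)"
    if "compatible_module B LR m lr Y \<rho>" for Y \<rho>
    using that M.coaction_coassoc[OF that[unfolded compat]] M.coaction_action[OF that[unfolded compat]]
      M.coaction_linear[OF that[unfolded compat]]
    by (simp only: compatible_module_def frob)
  \<comment> \<open>Left linearity of \<open>d\<close> is the module morphism law between free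
    modules; the symmetry \<open>e_F_eq\<close> brings compatibility into the form
    \<open>d_compatible\<close>.\<close>
  have 1: "compatible_module_morphism B LR m \<eta>t (omap LR Y) (m Y) (omap LR (omap LR Y))
      (m (omap LR Y)) ((L \<triangleright> \<eta>h \<triangleleft> R) Y)" if [simp]: "Y \<in> Obj B" for Y
    using M.d_left_linear[of Y] M.d_compatible[of Y] M.d.component_in_hom[of Y]
    by (simp add: compatible_module_morphism_def module_morphism_def M.nonunital_module_free M.e_F_eq
       del: whisker_simps fctr_simps) (simp add: fctr_simps)
  have 2: "\<exists>!\<omega>. compatible_module_morphism B LR m \<eta>t Y \<rho> (omap LR Y) (m Y) \<omega> \<and>
      frobenius_bimodule B R L \<eta>h \<epsilon>t Y \<rho> \<omega>"
    and 3: "compatible_module_morphism B LR m \<eta>t Y \<rho> (omap LR Y) (m Y) (M.coaction Y \<rho>)"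
    if "compatible_module B LR m lr Y \<rho>" for Y \<rho>
  proof -
    note Y = that[unfolded compat]
    show "compatible_module_morphism B LR m \<eta>t Y \<rho> (omap LR Y) (m Y) (M.coaction Y \<rho>)"
      by (rule M.coaction_module_morphism[OF Y])
    moreover have "\<omega> = M.coaction Y \<rho>"
      if "compatible_module_morphism B LR m \<eta>t Y \<rho> (omap LR Y) (m Y) \<omega>"
        "frobenius_bimodule B R L \<eta>h \<epsilon>t Y \<rho> \<omega>" for \<omega>
      using that by (intro M.coaction_unique[OF Y])
        (simp_all only: frob compatible_module_morphism_def module_morphism_def)
    ultimately show "\<exists>!\<omega>. compatible_module_morphism B LR m \<eta>t Y \<rho> (omap LR Y) (m Y) \<omega> \<and>
        frobenius_bimodule B R L \<eta>h \<epsilon>t Y \<rho> \<omega>"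
      using frob_coact[OF \<open>compatible_module B LR m lr Y \<rho>\<close>] by blast
  qed
  have 4: "bimodule_morphism B R L \<eta>h \<epsilon>t Y \<rho> (M.coaction Y \<rho>) Y' \<rho>' (M.coaction Y' \<rho>') h"
    if "compatible_module B LR m lr Y \<rho>" "compatible_module B LR m lr Y' \<rho>'"
      "module_morphism B LR m Y \<rho> Y' \<rho>' h" for Y \<rho> Y' \<rho>' h
    using that frob_coact M.comodule_morphism_coaction[OF that[unfolded compat]]
    by (simp add: bimodule_morphism_def LR m)
  have "(L \<triangleright> \<eta>h \<triangleleft> R) Y = vcomp B (L \<triangleright> \<eta>h \<triangleleft> R) lr Y" if "Y \<in> Obj B" for Y
    using M.d_compatible[OF that] lr'[OF that] by (simp add: vcomp_def)
  moreover have "\<forall>X \<in> Obj A. \<eta>h X = vcomp A rl \<eta>h X"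
    using inv by simp
  ultimately show ?thesis
    using nat 1 2 3 4 frob_coact M.weak_monad_axioms
    unfolding coact Let_def by (intro conjI allI ballI impI) (blast+)
qed

end
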